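(* Let $K\subseteq\mathbb{R}^n$ be a proper convex cone, and suppose that $f\in\mathbb{R}[x_1,\dots,x_n]$ is $K$-completely log-concave. Then $f$ is linewise $K$-completely log-concave.
   Context: A proper convex cone $K\subseteq\mathbb{R}^n$ is a nonempty convex set with $cK\subseteq K$ for all $c\ge0$ that is closed, pointed ($K\cap(-K)=\{0\}$) and has nonempty interior $\operatorname{int}K$. For $a\in\mathbb{R}^n$, $D_af=\sum_i a_i\,\partial f/\partial x_i$. A polynomial $f$ is log-concave at a point $a$ if $f(a)>0$ and the Hessian of $\log f$ at $a$ is negative semidefinite; by convention the zero polynomial is log-concave at all points. A polynomial $f$ of degree at most $d$ is $K$-completely log-concave ($K$-CLC) if for all $0\le m\le d$ and all $a_1,\dots,a_m\in K$, the polynomial $D_{a_1}\cdots D_{a_m}f$ is log-concave at every point of $\operatorname{int}K$. For $x\in\operatorname{int}K$ and $v\in K\setminus\{0\}$ set $I_{x,v}=\{t\in\mathbb{R}:x+tv\in\operatorname{int}K\}$ and $g_{x,v}(t)=f(x+tv)$ for $t\in I_{x,v}$. The polynomial $f$ is linewise $K$-completely log-concave if for every $x\in\operatorname{int}K$ and $v\in K\setminus\{0\}$ and every integer $m\ge0$, the derivative $g_{x,v}^{(m)}$ is log-concave on $I_{x,v}$. A univariate polynomial $h$ is log-concave on an interval $I$ if either $h\equiv 0$, or $h(t)>0$ and $h(t)h''(t)\le h'(t)^2$ for all $t\in I$. *)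

theory Defs
  imports
    "HOL-Analysis.Analysis"
    "HOL-Library.Poly_Mapping"
    "HOL-Computational_Algebra.Polynomial"
begin

section \<open>Multivariate polynomials over the reals\<close>

text \<open>
  An element of \<open>'n mpoly_real\<close> is a formal polynomial in the variables \<open>x\<^sub>i\<close> (\<open>i :: 'n\<close>): a finitely
  supported map from exponent vectors to coefficients.
\<close>

type_synonym 'n mpoly_real = "('n \<Rightarrow>\<^sub>0 nat) \<Rightarrow>\<^sub>0 real"

definition mp_eval :: "'n::finite mpoly_real \<Rightarrow> real ^ 'n \<Rightarrow> real" where
  "mp_eval f x =
     (\<Sum>\<alpha>\<in>Poly_Mapping.keys f. Poly_Mapping.lookup f \<alpha> * (\<Prod>i\<in>UNIV. (x $ i) ^ Poly_Mapping.lookup \<alpha> i))"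

definition mp_degree_le :: "'n::finite mpoly_real \<Rightarrow> nat \<Rightarrow> bool" where
  "mp_degree_le f d \<longleftrightarrow> (\<forall>\<alpha>\<in>Poly_Mapping.keys f. (\<Sum>i\<in>UNIV. Poly_Mapping.lookup \<alpha> i) \<le> d)"

text \<open>
  The formal partial derivative. The subtraction of exponent vectors is truncated, which is harmless:
  it only truncates when the exponent of \<open>x\<^sub>i\<close> is \<open>0\<close>, and then the coefficient is \<open>0\<close>.
\<close>

definition mp_pderiv :: "'n::finite \<Rightarrow> 'n mpoly_real \<Rightarrow> 'n mpoly_real" where
  "mp_pderiv i f =
     (\<Sum>\<alpha>\<in>Poly_Mapping.keys f.
        Poly_Mapping.single (\<alpha> - Poly_Mapping.single i 1)
          (real (Poly_Mapping.lookup \<alpha> i) * Poly_Mapping.lookup f \<alpha>))"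

definition mp_dir_deriv :: "real ^ 'n \<Rightarrow> 'n::finite mpoly_real \<Rightarrow> 'n mpoly_real" where
  "mp_dir_deriv a f = (\<Sum>i\<in>UNIV. Poly_Mapping.single 0 (a $ i) * mp_pderiv i f)"

text \<open>The univariate polynomial \<open>f(x + t v)\<close> in \<open>t\<close>, cf. \<open>poly_mp_line\<close> below.\<close>

definition mp_line :: "'n::finite mpoly_real \<Rightarrow> real ^ 'n \<Rightarrow> real ^ 'n \<Rightarrow> real poly" where
  "mp_line f x v =
     (\<Sum>\<alpha>\<in>Poly_Mapping.keys f.
        smult (Poly_Mapping.lookup f \<alpha>) (\<Prod>i\<in>UNIV. [:x $ i, v $ i:] ^ Poly_Mapping.lookup \<alpha> i))"

lemma poly_mp_line: "poly (mp_line f x v) t = mp_eval f (x + t *\<^sub>R v)"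
  by (simp add: mp_line_def mp_eval_def poly_sum poly_prod)

lemma mp_eval_superset:
  assumes "finite S" "Poly_Mapping.keys f \<subseteq> S"
  shows "mp_eval f x =
    (\<Sum>\<alpha>\<in>S. Poly_Mapping.lookup f \<alpha> * (\<Prod>i\<in>UNIV. (x $ i) ^ Poly_Mapping.lookup \<alpha> i))"
  unfolding mp_eval_def using assms
  by (intro sum.mono_neutral_left) (auto simp: in_keys_iff)

lemma mp_eval_zero [simp]: "mp_eval 0 x = 0"
  by (simp add: mp_eval_def)

lemma mp_eval_add: "mp_eval (f + g) x = mp_eval f x + mp_eval g x"
proof -
  let ?S = "Poly_Mapping.keys f \<union> Poly_Mapping.keys g"
  have "finite ?S" "Poly_Mapping.keys (f + g) \<subseteq> ?S"
    by (auto simp: Poly_Mapping.keys_add)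
  then show ?thesis
    by (simp add: mp_eval_superset [of ?S] lookup_add distrib_right sum.distrib)
qed

lemma mp_eval_sum: "mp_eval (sum F A) x = (\<Sum>a\<in>A. mp_eval (F a) x)"
  by (induction A rule: infinite_finite_induct) (auto simp: mp_eval_add)

lemma mp_eval_single:
  "mp_eval (Poly_Mapping.single \<alpha> c) x = c * (\<Prod>i\<in>UNIV. (x $ i) ^ Poly_Mapping.lookup \<alpha> i)"
  by (subst mp_eval_superset [of "{\<alpha>}"]) auto

lemma mp_expand:
  "f = (\<Sum>\<alpha>\<in>Poly_Mapping.keys f. Poly_Mapping.single \<alpha> (Poly_Mapping.lookup f \<alpha>))"
  by (rule poly_mapping_eqI)
    (auto simp: lookup_sum lookup_single when_def sum.delta in_keys_iff)

lemma mp_eval_const_mult: "mp_eval (Poly_Mapping.single 0 c * f) x = c * mp_eval f x"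
proof -
  have "Poly_Mapping.single 0 c * f =
      (\<Sum>\<alpha>\<in>Poly_Mapping.keys f. Poly_Mapping.single \<alpha> (c * Poly_Mapping.lookup f \<alpha>))"
    by (subst mp_expand [of f]) (simp add: sum_distrib_left mult_single)
  then have "mp_eval (Poly_Mapping.single 0 c * f) x =
      (\<Sum>\<alpha>\<in>Poly_Mapping.keys f. c * Poly_Mapping.lookup f \<alpha> * (\<Prod>i\<in>UNIV. (x $ i) ^ Poly_Mapping.lookup \<alpha> i))"
    by (simp only: mp_eval_sum mp_eval_single)
  then show ?thesis
    by (simp add: mp_eval_def sum_distrib_left mult.assoc)
qed

lemma mp_eval_pderiv:
  "mp_eval (mp_pderiv i f) x =
     (\<Sum>\<alpha>\<in>Poly_Mapping.keys f. Poly_Mapping.lookup f \<alpha> *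
        (real (Poly_Mapping.lookup \<alpha> i) * (x $ i) ^ (Poly_Mapping.lookup \<alpha> i - 1) *
         (\<Prod>j\<in>UNIV - {i}. (x $ j) ^ Poly_Mapping.lookup \<alpha> j)))"
  unfolding mp_pderiv_def mp_eval_sum mp_eval_single
proof (rule sum.cong [OF refl])
  fix \<alpha> :: "'a \<Rightarrow>\<^sub>0 nat"
  have "(\<Prod>j\<in>UNIV. (x $ j) ^ Poly_Mapping.lookup (\<alpha> - Poly_Mapping.single i 1) j) =
      (x $ i) ^ (Poly_Mapping.lookup \<alpha> i - 1) * (\<Prod>j\<in>UNIV - {i}. (x $ j) ^ Poly_Mapping.lookup \<alpha> j)"
    by (subst prod.remove [of _ i]) (auto simp: lookup_minus lookup_single when_def intro!: prod.cong)
  then show "real (Poly_Mapping.lookup \<alpha> i) * Poly_Mapping.lookup f \<alpha> *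
      (\<Prod>j\<in>UNIV. (x $ j) ^ Poly_Mapping.lookup (\<alpha> - Poly_Mapping.single i 1) j) =
      Poly_Mapping.lookup f \<alpha> *
        (real (Poly_Mapping.lookup \<alpha> i) * (x $ i) ^ (Poly_Mapping.lookup \<alpha> i - 1) *
         (\<Prod>j\<in>UNIV - {i}. (x $ j) ^ Poly_Mapping.lookup \<alpha> j))"
    by simp
qed

text \<open>The formal directional derivative agrees with the analytic one.\<close>

lemma has_real_derivative_mp_eval_line:
  "((\<lambda>t. mp_eval f (x + t *\<^sub>R a)) has_real_derivative mp_eval (mp_dir_deriv a f) (x + t *\<^sub>R a)) (at t)"
proof -
  define y where "y = x + t *\<^sub>R a"
  let ?M = "\<lambda>\<alpha> i. (real (Poly_Mapping.lookup \<alpha> i) * (y $ i) ^ (Poly_Mapping.lookup \<alpha> i - 1) *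
         (\<Prod>j\<in>UNIV - {i}. (y $ j) ^ Poly_Mapping.lookup \<alpha> j))"
  have 1: "mp_eval (mp_dir_deriv a f) y =
      (\<Sum>\<alpha>\<in>Poly_Mapping.keys f. Poly_Mapping.lookup f \<alpha> * (\<Sum>i\<in>UNIV. a $ i * ?M \<alpha> i))"
    unfolding mp_dir_deriv_def mp_eval_sum mp_eval_const_mult mp_eval_pderiv sum_distrib_left
    by (subst sum.swap) (simp add: mult.left_commute)
  have 2: "((\<lambda>t. \<Prod>i\<in>UNIV. ((x + t *\<^sub>R a) $ i) ^ Poly_Mapping.lookup \<alpha> i) has_real_derivative
      (\<Sum>i\<in>UNIV. a $ i * ?M \<alpha> i)) (at t)" for \<alpha> :: "'a \<Rightarrow>\<^sub>0 nat"
  proof -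
    have "((\<lambda>t. \<Prod>i\<in>UNIV. ((x + t *\<^sub>R a) $ i) ^ Poly_Mapping.lookup \<alpha> i) has_real_derivative
      (\<Sum>i\<in>UNIV. (a $ i * real (Poly_Mapping.lookup \<alpha> i) * (y $ i) ^ (Poly_Mapping.lookup \<alpha> i - 1)) *
         (\<Prod>j\<in>UNIV - {i}. ((x + t *\<^sub>R a) $ j) ^ Poly_Mapping.lookup \<alpha> j))) (at t)"
      by (rule has_field_derivative_prod) (auto intro!: derivative_eq_intros simp: y_def)
    then show ?thesis
      by (simp add: y_def mult.assoc)
  qed
  show ?thesis
    unfolding y_def [symmetric] 1
    unfolding mp_eval_def
    by (intro DERIV_sum DERIV_cmult 2)
qed


section \<open>Log-concavity\<close>

definition partial_deriv :: "'n::finite \<Rightarrow> (real ^ 'n \<Rightarrow> real) \<Rightarrow> real ^ 'n \<Rightarrow> real" where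
  "partial_deriv i F x = deriv (\<lambda>t. F (x + t *\<^sub>R axis i 1)) 0"

definition hessian :: "(real ^ 'n::finite \<Rightarrow> real) \<Rightarrow> real ^ 'n \<Rightarrow> real ^ 'n ^ 'n" where
  "hessian F x = (\<chi> i j. partial_deriv i (partial_deriv j F) x)"

definition negative_semidefinite :: "real ^ 'n ^ 'n::finite \<Rightarrow> bool" where
  "negative_semidefinite A \<longleftrightarrow> transpose A = A \<and> (\<forall>u. u \<bullet> (A *v u) \<le> 0)"

definition log_concave_at :: "'n::finite mpoly_real \<Rightarrow> real ^ 'n \<Rightarrow> bool" where
  "log_concave_at f a \<longleftrightarrow>
     f = 0 \<or> (mp_eval f a > 0 \<and> negative_semidefinite (hessian (\<lambda>x. ln (mp_eval f x)) a))"

definition poly_log_concave_on :: "real poly \<Rightarrow> real set \<Rightarrow> bool" where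
  "poly_log_concave_on h I \<longleftrightarrow>
     h = 0 \<or>
     (\<forall>t\<in>I. poly h t > 0 \<and> poly h t * poly (pderiv (pderiv h)) t \<le> (poly (pderiv h) t)\<^sup>2)"


section \<open>Complete log-concavity with respect to a cone\<close>

definition proper_convex_cone :: "(real ^ 'n::finite) set \<Rightarrow> bool" where
  "proper_convex_cone K \<longleftrightarrow>
     convex_cone K \<and> closed K \<and> K \<inter> uminus ` K = {0} \<and> interior K \<noteq> {}"

text \<open>
  Here \<open>d\<close> is any bound on the degree of \<open>f\<close>. The list \<open>[a\<^sub>1, \<dots>, a\<^sub>m]\<close> supplies the directions, so that
  \<open>foldr mp_dir_deriv [a\<^sub>1, \<dots>, a\<^sub>m] f\<close> is \<open>D\<^bsub>a\<^sub>1\<^esub> (\<dots> (D\<^bsub>a\<^sub>m\<^esub> f))\<close>.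
\<close>

definition completely_log_concave :: "(real ^ 'n::finite) set \<Rightarrow> nat \<Rightarrow> 'n mpoly_real \<Rightarrow> bool" where
  "completely_log_concave K d f \<longleftrightarrow>
     mp_degree_le f d \<and>
     (\<forall>m\<le>d. \<forall>as. length as = m \<and> set as \<subseteq> K \<longrightarrow>
        (\<forall>x\<in>interior K. log_concave_at (foldr mp_dir_deriv as f) x))"

definition linewise_completely_log_concave :: "(real ^ 'n::finite) set \<Rightarrow> 'n mpoly_real \<Rightarrow> bool" where
  "linewise_completely_log_concave K f \<longleftrightarrow>
     (\<forall>x\<in>interior K. \<forall>v\<in>K - {0}. \<forall>m.
        poly_log_concave_on ((pderiv ^^ m) (mp_line f x v)) {t. x + t *\<^sub>R v \<in> interior K})"

end

theory Submission
  imports Defs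
begin

text \<open>
  Restricting to the line \<open>t \<mapsto> x + t v\<close> turns the univariate derivative into the directional
  derivative: the \<open>m\<close>-th derivative of \<open>f(x + t v)\<close> is the restriction of \<open>D\<^sub>v\<^sup>m f\<close>
  (\<open>higher_pderiv_mp_line\<close>). Complete log-concavity, applied to the \<open>m\<close> equal directions
  \<open>v, \<dots>, v\<close>, says that \<open>g = D\<^sub>v\<^sup>m f\<close> is either zero or positive with negative semidefinite
  \<open>H = \<nabla>\<^sup>2 log g\<close> on the interior of \<open>K\<close>. The quadratic form of \<open>H\<close> in the direction of the line is
  \<open>v\<^sup>T H v = (g D\<^sub>v\<^sup>2 g - (D\<^sub>v g)\<^sup>2) / g\<^sup>2\<close> (\<open>hessian_ln_quadratic_form\<close>), and its nonpositivity is
  exactly the univariate condition. This covers \<open>m \<le> d\<close>; for \<open>m > d\<close> the derivative vanishes because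
  restriction to a line does not increase the degree (\<open>degree_mp_line_le\<close>).

  Identities between formal directional derivatives are obtained by evaluating both sides and
  appealing to uniqueness of analytic derivatives.
\<close>

lemma mp_eval_dir_deriv:
  "mp_eval (mp_dir_deriv a f) x = (\<Sum>i\<in>UNIV. a $ i * mp_eval (mp_pderiv i f) x)"
  by (simp add: mp_dir_deriv_def mp_eval_sum mp_eval_const_mult)

lemma has_real_derivative_mp_eval_axis:
  "((\<lambda>t. mp_eval f (x + t *\<^sub>R axis i 1)) has_real_derivative
     mp_eval (mp_pderiv i f) (x + t *\<^sub>R axis i 1)) (at t)"
proof -
  have "mp_eval (mp_dir_deriv (axis i 1) f) y = mp_eval (mp_pderiv i f) y" for y
  proof -
    have "mp_eval (mp_dir_deriv (axis i 1) f) y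
        = (\<Sum>j\<in>UNIV. if j = i then mp_eval (mp_pderiv j f) y else 0)"
      unfolding mp_eval_dir_deriv by (rule sum.cong) (auto simp: axis_def)
    then show ?thesis by simp
  qed
  then show ?thesis
    using has_real_derivative_mp_eval_line[of f x "axis i 1" t] by simp
qed

lemma mp_eval_dir_deriv_dir_deriv:
  "mp_eval (mp_dir_deriv a (mp_dir_deriv b f)) x
     = (\<Sum>i\<in>UNIV. \<Sum>j\<in>UNIV. a $ i * b $ j * mp_eval (mp_pderiv i (mp_pderiv j f)) x)"
proof -
  have "mp_eval (mp_pderiv i (mp_dir_deriv b f)) x
      = (\<Sum>j\<in>UNIV. b $ j * mp_eval (mp_pderiv i (mp_pderiv j f)) x)" for i
  proof -
    have "((\<lambda>t. mp_eval (mp_dir_deriv b f) (x + t *\<^sub>R axis i 1)) has_real_derivative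
        (\<Sum>j\<in>UNIV. b $ j * mp_eval (mp_pderiv i (mp_pderiv j f)) (x + 0 *\<^sub>R axis i 1))) (at 0)"
      unfolding mp_eval_dir_deriv
      by (intro DERIV_sum DERIV_cmult has_real_derivative_mp_eval_axis)
    from DERIV_unique[OF this has_real_derivative_mp_eval_axis] show ?thesis by simp
  qed
  then show ?thesis
    by (simp add: mp_eval_dir_deriv[of a] sum_distrib_left mult.assoc)
qed

lemma pderiv_mp_line: "pderiv (mp_line f x v) = mp_line (mp_dir_deriv v f) x v"
proof (rule poly_eq_poly_eq_iff[THEN iffD1], rule ext)
  fix t
  have "(poly (mp_line f x v) has_real_derivative
      poly (mp_line (mp_dir_deriv v f) x v) t) (at t)"
    using has_real_derivative_mp_eval_line[of f x v t] by (simp add: poly_mp_line[abs_def])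
  from DERIV_unique[OF poly_DERIV this]
  show "poly (pderiv (mp_line f x v)) t = poly (mp_line (mp_dir_deriv v f) x v) t" .
qed

lemma higher_pderiv_mp_line:
  "(pderiv ^^ m) (mp_line f x v) = mp_line (foldr mp_dir_deriv (replicate m v) f) x v"
  by (induction m) (simp_all add: pderiv_mp_line)

lemma degree_mp_line_le:
  assumes "mp_degree_le f d"
  shows "degree (mp_line f x v) \<le> d"
  unfolding mp_line_def
proof (rule degree_sum_le)
  fix \<alpha> assume \<alpha>: "\<alpha> \<in> Poly_Mapping.keys f"
  let ?p = "\<lambda>i. [:x $ i, v $ i:] ^ Poly_Mapping.lookup \<alpha> i"
  have "degree (smult (Poly_Mapping.lookup f \<alpha>) (\<Prod>i\<in>UNIV. ?p i)) \<le> degree (\<Prod>i\<in>UNIV. ?p i)"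
    by (rule degree_smult_le)
  also have "\<dots> \<le> (\<Sum>i\<in>UNIV. degree (?p i))"
    using degree_prod_sum_le[of UNIV ?p] by (simp add: o_def)
  also have "\<dots> \<le> (\<Sum>i\<in>UNIV. Poly_Mapping.lookup \<alpha> i)"
  proof (rule sum_mono)
    fix i
    have "degree (?p i) \<le> degree [:x $ i, v $ i:] * Poly_Mapping.lookup \<alpha> i"
      by (rule degree_power_le)
    also have "\<dots> \<le> 1 * Poly_Mapping.lookup \<alpha> i"
      by (rule mult_right_mono) auto
    finally show "degree (?p i) \<le> Poly_Mapping.lookup \<alpha> i" by simp
  qed
  also have "\<dots> \<le> d" using assms \<alpha> by (simp add: mp_degree_le_def)
  finally show "degree (smult (Poly_Mapping.lookup f \<alpha>) (\<Prod>i\<in>UNIV. ?p i)) \<le> d" .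
qed simp

lemma higher_pderiv_eq_0:
  fixes p :: "'a::{comm_semiring_1,semiring_no_zero_divisors,semiring_char_0} poly"
  assumes "degree p < m"
  shows "(pderiv ^^ m) p = 0"
proof -
  have deg: "degree ((pderiv ^^ k) p) = degree p - k" for k
    by (induction k) (simp_all add: degree_pderiv)
  obtain k where "m = Suc k" "degree p \<le> k"
    using assms by (cases m) auto
  with deg[of k] show ?thesis by (simp add: pderiv_eq_0_iff)
qed

lemma partial_deriv_ln_mp_eval:
  assumes "mp_eval g x > 0"
  shows "partial_deriv j (\<lambda>x. ln (mp_eval g x)) x = mp_eval (mp_pderiv j g) x / mp_eval g x"
proof -
  have "((\<lambda>t. ln (mp_eval g (x + t *\<^sub>R axis j 1))) has_real_derivative
      mp_eval (mp_pderiv j g) x / mp_eval g x) (at 0)"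
    using DERIV_chain2[OF DERIV_ln has_real_derivative_mp_eval_axis[of g x j 0]] assms
    by (simp add: field_simps)
  then show ?thesis
    unfolding partial_deriv_def by (rule DERIV_imp_deriv)
qed

text \<open>
  The formula for the first partial derivatives holds only where \<open>g\<close> is positive, so the second
  derivative needs it in a neighbourhood of \<open>x\<close>; on the line through \<open>x\<close> in a coordinate
  direction, continuity of \<open>g\<close> provides one.
\<close>

lemma hessian_ln_mp_eval:
  assumes pos: "mp_eval g x > 0"
  shows "hessian (\<lambda>x. ln (mp_eval g x)) x $ i $ j
    = (mp_eval (mp_pderiv i (mp_pderiv j g)) x * mp_eval g x
        - mp_eval (mp_pderiv i g) x * mp_eval (mp_pderiv j g) x) / (mp_eval g x)\<^sup>2"
    (is "_ = ?R")
proof -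
  let ?y = "\<lambda>t. x + t *\<^sub>R axis i 1"
  have "isCont (\<lambda>t. mp_eval g (?y t)) 0"
    using has_real_derivative_mp_eval_axis by (rule DERIV_isCont)
  then have "\<forall>\<^sub>F t in nhds 0. mp_eval g (?y t) > 0"
    using pos order_tendstoD(1)[of "\<lambda>t. mp_eval g (?y t)" _ "nhds 0" 0]
    by (simp add: isCont_def tendsto_nhds_iff)
  then have ev: "\<forall>\<^sub>F t in nhds 0. mp_eval (mp_pderiv j g) (?y t) / mp_eval g (?y t)
      = partial_deriv j (\<lambda>x. ln (mp_eval g x)) (?y t)"
    by eventually_elim (simp add: partial_deriv_ln_mp_eval)
  have "((\<lambda>t. mp_eval (mp_pderiv j g) (?y t) / mp_eval g (?y t)) has_real_derivative ?R) (at 0)"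
    using DERIV_divide[OF has_real_derivative_mp_eval_axis[of "mp_pderiv j g" x i 0]
        has_real_derivative_mp_eval_axis[of g x i 0]] pos
    by (simp add: power2_eq_square mult.commute)
  then have "((\<lambda>t. partial_deriv j (\<lambda>x. ln (mp_eval g x)) (?y t)) has_real_derivative ?R) (at 0)"
    using DERIV_cong_ev[OF refl ev refl] by simp
  then show ?thesis
    by (simp add: hessian_def partial_deriv_def[of i] DERIV_imp_deriv)
qed

lemma hessian_ln_quadratic_form:
  assumes pos: "mp_eval g x > 0"
  shows "v \<bullet> (hessian (\<lambda>x. ln (mp_eval g x)) x *v v)
    = (mp_eval g x * mp_eval (mp_dir_deriv v (mp_dir_deriv v g)) x
        - (mp_eval (mp_dir_deriv v g) x)\<^sup>2) / (mp_eval g x)\<^sup>2"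
proof -
  let ?G = "mp_eval g x"
  let ?P = "\<lambda>i. mp_eval (mp_pderiv i g) x"
  let ?Q = "\<lambda>i j. mp_eval (mp_pderiv i (mp_pderiv j g)) x"
  have "v \<bullet> (hessian (\<lambda>x. ln (mp_eval g x)) x *v v)
      = (\<Sum>i\<in>UNIV. \<Sum>j\<in>UNIV. v $ i * ((?Q i j * ?G - ?P i * ?P j) / ?G\<^sup>2 * v $ j))"
    by (simp add: inner_vec_def matrix_vector_mult_def hessian_ln_mp_eval[OF pos] sum_distrib_left)
  also have "\<dots> = (\<Sum>i\<in>UNIV. \<Sum>j\<in>UNIV.
      (?G * (v $ i * v $ j * ?Q i j) - (v $ i * ?P i) * (v $ j * ?P j)) / ?G\<^sup>2)"
    by (intro sum.cong refl) (simp add: field_simps)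
  also have "\<dots> = (?G * (\<Sum>i\<in>UNIV. \<Sum>j\<in>UNIV. v $ i * v $ j * ?Q i j)
      - (\<Sum>i\<in>UNIV. v $ i * ?P i) * (\<Sum>j\<in>UNIV. v $ j * ?P j)) / ?G\<^sup>2"
    unfolding sum_product by (simp add: sum_divide_distrib[symmetric] sum_subtractf sum_distrib_left)
  finally show ?thesis
    unfolding mp_eval_dir_deriv_dir_deriv
    by (simp add: mp_eval_dir_deriv power2_eq_square)
qed

lemma log_concave_at_imp_dir_deriv_le:
  assumes "log_concave_at g x" and "g \<noteq> 0"
  shows "mp_eval g x > 0"
    and "mp_eval g x * mp_eval (mp_dir_deriv v (mp_dir_deriv v g)) x
           \<le> (mp_eval (mp_dir_deriv v g) x)\<^sup>2"
proof -
  show pos: "mp_eval g x > 0"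
    using assms by (simp add: log_concave_at_def)
  have "v \<bullet> (hessian (\<lambda>x. ln (mp_eval g x)) x *v v) \<le> 0"
    using assms by (simp add: log_concave_at_def negative_semidefinite_def)
  then show "mp_eval g x * mp_eval (mp_dir_deriv v (mp_dir_deriv v g)) x
      \<le> (mp_eval (mp_dir_deriv v g) x)\<^sup>2"
    using pos by (simp add: hessian_ln_quadratic_form divide_le_0_iff)
qed

lemma poly_log_concave_on_mp_line:
  assumes "\<And>y. y \<in> S \<Longrightarrow> log_concave_at g y"
  shows "poly_log_concave_on (mp_line g x v) {t. x + t *\<^sub>R v \<in> S}"
proof (cases "g = 0")
  case True
  then show ?thesis by (simp add: poly_log_concave_on_def mp_line_def)
next
  case False
  then show ?thesis
    unfolding poly_log_concave_on_def pderiv_mp_line poly_mp_line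
    using log_concave_at_imp_dir_deriv_le assms by blast
qed

theorem proposition3p13:
  fixes K :: "(real ^ 'n::finite) set"
    and f :: "'n mpoly_real"
    and d :: nat
  assumes "proper_convex_cone K"
    and "completely_log_concave K d f"
  shows "linewise_completely_log_concave K f"
  unfolding linewise_completely_log_concave_def
proof (intro ballI allI)
  fix x v m
  assume v: "v \<in> K - {0}"
  show "poly_log_concave_on ((pderiv ^^ m) (mp_line f x v)) {t. x + t *\<^sub>R v \<in> interior K}"
  proof (cases "m \<le> d")
    case True
    have "log_concave_at (foldr mp_dir_deriv (replicate m v) f) y" if "y \<in> interior K" for y
    proof -
      have "length (replicate m v) = m \<and> set (replicate m v) \<subseteq> K"
        using v by auto
      then show ?thesis
        using assms(2) True that unfolding completely_log_concave_def by blast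
    qed
    then show ?thesis
      unfolding higher_pderiv_mp_line by (rule poly_log_concave_on_mp_line)
  next
    case False
    have "degree (mp_line f x v) \<le> d"
      using assms(2) by (intro degree_mp_line_le) (simp add: completely_log_concave_def)
    with False show ?thesis
      by (simp add: higher_pderiv_eq_0 poly_log_concave_on_def)
  qed
qed

end
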